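(* Let $J\in\mathbb{N}$, let $\boldsymbol{c}^{(J)}$ and $\widetilde{\boldsymbol{c}}^{(J)}$ be two bounded real bi-infinite sequences, and let $\mathcal{S}_{\boldsymbol{\alpha}^{(\ell)}}$, $\ell=1,\dots,J$, be subdivision operators with finitely supported real masks $\boldsymbol{\alpha}^{(\ell)}$. Let $\mathcal{D}_{\boldsymbol{\gamma}^{(\ell)}}$, $\ell=1,\dots,J$, be the corresponding decimation operators, i.e. $\boldsymbol{\gamma}^{(\ell)}$ is an absolutely summable real bi-infinite sequence with $\boldsymbol{\gamma}^{(\ell)}*(\boldsymbol{\alpha}^{(\ell)}\downarrow2)=\boldsymbol{\delta}$, and assume that the elements of each $\boldsymbol{\gamma}^{(\ell)}$ sum to $1$. Let $$\mathcal{Q}_{\ell,J}=\mathcal{D}_{\boldsymbol{\gamma}^{(\ell+1)}}\mathcal{D}_{\boldsymbol{\gamma}^{(\ell+2)}}\cdots\mathcal{D}_{\boldsymbol{\gamma}^{(J)}},\quad \ell=0,\dots,J-1,\qquad \mathcal{Q}_{J,J}=\mathcal{I}.$$ Let $\{\boldsymbol{c}^{(0)},\boldsymbol{d}^{(1)},\dots,\boldsymbol{d}^{(J)}\}$ be the multiscale representation of $\boldsymbol{c}^{(J)}$ obtained by iterating, for $\ell=J,J-1,\dots,1$, $$\boldsymbol{c}^{(\ell-1)}=\mathcal{D}_{\boldsymbol{\gamma}^{(\ell)}}\boldsymbol{c}^{(\ell)},\qquad \boldsymbol{d}^{(\ell)}=\boldsymbol{c}^{(\ell)}-\mathcal{S}_{\boldsymbol{\alpha}^{(\ell)}}\boldsymbol{c}^{(\ell-1)},$$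 and let $\{\widetilde{\boldsymbol{c}}^{(0)},\widetilde{\boldsymbol{d}}^{(1)},\dots,\widetilde{\boldsymbol{d}}^{(J)}\}$ be obtained from $\widetilde{\boldsymbol{c}}^{(J)}$ in the same way. Then $$\|\boldsymbol{c}^{(0)}-\widetilde{\boldsymbol{c}}^{(0)}\|_\infty\le\|\mathcal{Q}_{0,J}\|_\infty\,\|\boldsymbol{c}^{(J)}-\widetilde{\boldsymbol{c}}^{(J)}\|_\infty,$$ and $$\|\boldsymbol{d}^{(\ell)}-\widetilde{\boldsymbol{d}}^{(\ell)}\|_\infty\le\|\mathcal{I}-\mathcal{S}_{\boldsymbol{\alpha}^{(\ell)}}\mathcal{D}_{\boldsymbol{\gamma}^{(\ell)}}\|_\infty\,\|\mathcal{Q}_{\ell,J}\|_\infty\,\|\boldsymbol{c}^{(J)}-\widetilde{\boldsymbol{c}}^{(J)}\|_\infty,\qquad \ell=1,\dots,J.$$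
   Context: Sequences are real-valued and bi-infinite (indexed by $\mathbb{Z}$). For a finitely supported sequence (mask) $\boldsymbol{\alpha}$, the subdivision operator is $(\mathcal{S}_{\boldsymbol{\alpha}}\boldsymbol{c})_j=\sum_{i\in\mathbb{Z}}\alpha_{j-2i}c_i$, $j\in\mathbb{Z}$. For an absolutely summable sequence $\boldsymbol{\gamma}$, the decimation operator is $(\mathcal{D}_{\boldsymbol{\gamma}}\boldsymbol{c})_j=\sum_{i\in\mathbb{Z}}\gamma_{j-i}c_{2i}$, $j\in\mathbb{Z}$ (applied to bounded sequences). The downsampling operator is $(\boldsymbol{c}\downarrow 2)_j=c_{2j}$; $*$ is convolution of sequences; $\boldsymbol{\delta}$ is the Kronecker delta sequence ($\delta_0=1$, $\delta_i=0$ for $i\ne0$); $\mathcal{I}$ is the identity operator. $\|\boldsymbol{c}\|_\infty=\sup_j|c_j|$, and for linear operators $\|\cdot\|_\infty$ is the operator norm induced on bounded sequences, $\|\mathcal{T}\|_\infty=\sup_{\|\boldsymbol{c}\|_\infty\le1}\|\mathcal{T}\boldsymbol{c}\|_\infty$. *)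

theory Defs
  imports "HOL-Analysis.Analysis"
begin

type_synonym seq = "int \<Rightarrow> real"

definition finitely_supported :: "seq \<Rightarrow> bool" where
  "finitely_supported a \<longleftrightarrow> finite {i. a i \<noteq> 0}"

definition absolutely_summable :: "seq \<Rightarrow> bool" where
  "absolutely_summable a \<longleftrightarrow> (\<lambda>i. \<bar>a i\<bar>) summable_on UNIV"

definition bounded_seq :: "seq \<Rightarrow> bool" where
  "bounded_seq c \<longleftrightarrow> bounded (range c)"

definition delta :: seq where
  "delta i = (if i = 0 then 1 else 0)"

definition seq_conv :: "seq \<Rightarrow> seq \<Rightarrow> seq" where
  "seq_conv a b = (\<lambda>j. \<Sum>\<^sub>\<infinity>i. a (j - i) * b i)"

definition downsample :: "seq \<Rightarrow> seq" where
  "downsample c = (\<lambda>j. c (2 * j))"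

(* For a finitely supported mask this sum has only finitely many nonzero terms. *)
definition subdivision :: "seq \<Rightarrow> seq \<Rightarrow> seq" where
  "subdivision \<alpha> c = (\<lambda>j. \<Sum>\<^sub>\<infinity>i. \<alpha> (j - 2 * i) * c i)"

definition decimation :: "seq \<Rightarrow> seq \<Rightarrow> seq" where
  "decimation \<gamma> c = (\<lambda>j. \<Sum>\<^sub>\<infinity>i. \<gamma> (j - i) * c (2 * i))"

(* Real-valued supremum: meaningful only for bounded sequences. *)
definition sup_norm :: "seq \<Rightarrow> real" where
  "sup_norm c = (SUP j. \<bar>c j\<bar>)"

(* Boundedness of c is required explicitly, because sup_norm is unspecified on
   unbounded sequences.  The supremum is meaningful for operators that are bounded
   on the space of bounded sequences. *)
definition op_norm :: "(seq \<Rightarrow> seq) \<Rightarrow> real" where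
  "op_norm T = (SUP c \<in> {c. bounded_seq c \<and> sup_norm c \<le> 1}. sup_norm (T c))"

(* The composition D_(l+1) o D_(l+2) o ... o D_J, which is the identity for l = J. *)
definition Q_op :: "(nat \<Rightarrow> seq) \<Rightarrow> nat \<Rightarrow> nat \<Rightarrow> seq \<Rightarrow> seq" where
  "Q_op \<gamma> l J = foldr (\<circ>) (map (\<lambda>k. decimation (\<gamma> k)) [l + 1..<J + 1]) id"

(* c l and d l are the level-l sequences.  The data c J determines c l for l < J and
   d l for 1 <= l <= J; the values of c and d at other indices are irrelevant. *)
definition multiscale_rep ::
    "(nat \<Rightarrow> seq) \<Rightarrow> (nat \<Rightarrow> seq) \<Rightarrow> nat \<Rightarrow> (nat \<Rightarrow> seq) \<Rightarrow> (nat \<Rightarrow> seq) \<Rightarrow> bool" where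
  "multiscale_rep \<alpha> \<gamma> J c d \<longleftrightarrow>
     (\<forall>l\<in>{1..J}. c (l - 1) = decimation (\<gamma> l) (c l) \<and>
                 d l = c l - subdivision (\<alpha> l) (c (l - 1)))"

end

theory Submission
  imports Defs
begin

text \<open>
  The estimates are the operator norm inequality
  \<open>sup_norm (T x) \<le> op_norm T * sup_norm x\<close> applied to differences of the data. Iterating the
  decimation gives \<open>c l = Q_op \<gamma> l J (c J)\<close>, and hence
  \<open>d l = (I - S D) (Q_op \<gamma> l J (c J))\<close> where \<open>S\<close> and \<open>D\<close> are the subdivision and decimation
  operators of level \<open>l\<close>. By linearity the same identities hold for the differences of two
  representations.

  The norm inequality holds only for a bounded operator: \<open>op_norm\<close> is a real supremum, and infinite
  sums can be split only if they converge. So the work lies in showing that every operator involved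
  is linear and bounded on bounded sequences. Subdivision and decimation are both given by a
  matrix whose rows are uniformly absolutely summable, because each row is a rearranged selection
  of entries of one absolutely summable mask (\<open>row_summable_bounded_linear\<close>). Boundedness is
  preserved by composition and difference, which covers \<open>Q_op \<gamma> l J\<close> and \<open>I - S D\<close>.
\<close>

section \<open>Bounded sequences and the supremum norm\<close>

lemma bounded_seq_iff: "bounded_seq x \<longleftrightarrow> (\<exists>B. \<forall>j. \<bar>x j\<bar> \<le> B)"
  unfolding bounded_seq_def bounded_iff by auto

lemma bounded_seqI: "(\<And>j. \<bar>x j\<bar> \<le> B) \<Longrightarrow> bounded_seq x"
  unfolding bounded_seq_iff by blast

lemma abs_le_sup_norm:
  assumes "bounded_seq x"
  shows "\<bar>x j\<bar> \<le> sup_norm x"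
proof -
  have "bdd_above (range (\<lambda>j. \<bar>x j\<bar>))"
    using assms unfolding bounded_seq_iff bdd_above_def by auto
  then show ?thesis
    unfolding sup_norm_def by (intro cSUP_upper) auto
qed

lemma sup_norm_le: "(\<And>j. \<bar>x j\<bar> \<le> B) \<Longrightarrow> sup_norm x \<le> B"
  unfolding sup_norm_def by (intro cSUP_least) auto

lemma sup_norm_nonneg: "bounded_seq x \<Longrightarrow> 0 \<le> sup_norm x"
  using abs_le_sup_norm[of x 0] by linarith

lemma bounded_seq_diff:
  assumes "bounded_seq x" "bounded_seq y"
  shows "bounded_seq (x - y)"
proof (rule bounded_seqI)
  show "\<bar>(x - y) j\<bar> \<le> sup_norm x + sup_norm y" for j
    using abs_le_sup_norm[OF assms(1), of j] abs_le_sup_norm[OF assms(2), of j] by simp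
qed

lemma bounded_seq_scale:
  assumes "bounded_seq x"
  shows "bounded_seq (\<lambda>j. r * x j)"
  by (rule bounded_seqI[of _ "\<bar>r\<bar> * sup_norm x"])
    (simp add: abs_mult mult_left_mono abs_le_sup_norm[OF assms])

section \<open>Bounded linear operators on bounded sequences\<close>

text \<open>
  The laws are required on bounded sequences only, since the infinite sums that define the
  operators may diverge elsewhere. Differences rather than sums are used because functions carry
  a pointwise difference; together with homogeneity this amounts to linearity.
\<close>

definition bounded_linear_on_seqs :: "(seq \<Rightarrow> seq) \<Rightarrow> bool" where
  "bounded_linear_on_seqs T \<longleftrightarrow>
     (\<forall>x y. bounded_seq x \<longrightarrow> bounded_seq y \<longrightarrow> T (x - y) = T x - T y) \<and>
     (\<forall>r x. bounded_seq x \<longrightarrow> T (\<lambda>j. r * x j) = (\<lambda>j. r * T x j)) \<and>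
     (\<exists>B\<ge>0. \<forall>x. bounded_seq x \<longrightarrow> (\<forall>j. \<bar>T x j\<bar> \<le> B * sup_norm x))"

lemma bounded_linear_on_seqs_diff:
  "bounded_linear_on_seqs T \<Longrightarrow> bounded_seq x \<Longrightarrow> bounded_seq y \<Longrightarrow> T (x - y) = T x - T y"
  unfolding bounded_linear_on_seqs_def by blast

lemma bounded_linear_on_seqs_scale:
  "bounded_linear_on_seqs T \<Longrightarrow> bounded_seq x \<Longrightarrow> T (\<lambda>j. r * x j) = (\<lambda>j. r * T x j)"
  unfolding bounded_linear_on_seqs_def by blast

lemma bounded_linear_on_seqs_bound:
  assumes "bounded_linear_on_seqs T"
  obtains B where "B \<ge> 0" "\<And>x j. bounded_seq x \<Longrightarrow> \<bar>T x j\<bar> \<le> B * sup_norm x"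
  using assms unfolding bounded_linear_on_seqs_def by blast

lemma bounded_linear_on_seqs_bounded:
  assumes "bounded_linear_on_seqs T" "bounded_seq x"
  shows "bounded_seq (T x)"
proof -
  obtain B where "\<And>y j. bounded_seq y \<Longrightarrow> \<bar>T y j\<bar> \<le> B * sup_norm y"
    using bounded_linear_on_seqs_bound[OF assms(1)] by blast
  then show ?thesis
    using assms(2) by (intro bounded_seqI)
qed

lemma bounded_linear_on_seqs_id: "bounded_linear_on_seqs id"
  unfolding bounded_linear_on_seqs_def using abs_le_sup_norm
  by (auto intro!: exI[of _ 1])

lemma bounded_linear_on_seqs_comp:
  assumes S: "bounded_linear_on_seqs S" and T: "bounded_linear_on_seqs T"
  shows "bounded_linear_on_seqs (S \<circ> T)"
proof -
  note bT = bounded_linear_on_seqs_bounded[OF T]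
  obtain A where A: "A \<ge> 0" "\<And>x j. bounded_seq x \<Longrightarrow> \<bar>S x j\<bar> \<le> A * sup_norm x"
    using bounded_linear_on_seqs_bound[OF S] by blast
  obtain B where B: "B \<ge> 0" "\<And>x j. bounded_seq x \<Longrightarrow> \<bar>T x j\<bar> \<le> B * sup_norm x"
    using bounded_linear_on_seqs_bound[OF T] by blast
  have "\<bar>(S \<circ> T) x j\<bar> \<le> (A * B) * sup_norm x" if x: "bounded_seq x" for x j
  proof -
    have "\<bar>S (T x) j\<bar> \<le> A * sup_norm (T x)"
      using A(2) bT x by blast
    also have "\<dots> \<le> A * (B * sup_norm x)"
      using A(1) B(2) x by (intro mult_left_mono sup_norm_le)
    finally show ?thesis by simp
  qed
  moreover have "A * B \<ge> 0"
    using A(1) B(1) by simp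
  ultimately show ?thesis
    using bT unfolding bounded_linear_on_seqs_def
    by (auto simp: bounded_linear_on_seqs_diff[OF T] bounded_linear_on_seqs_diff[OF S]
        bounded_linear_on_seqs_scale[OF T] bounded_linear_on_seqs_scale[OF S])
qed

lemma bounded_linear_on_seqs_minus:
  assumes S: "bounded_linear_on_seqs S" and T: "bounded_linear_on_seqs T"
  shows "bounded_linear_on_seqs (S - T)"
proof -
  obtain A where A: "A \<ge> 0" "\<And>x j. bounded_seq x \<Longrightarrow> \<bar>S x j\<bar> \<le> A * sup_norm x"
    using bounded_linear_on_seqs_bound[OF S] by blast
  obtain B where B: "B \<ge> 0" "\<And>x j. bounded_seq x \<Longrightarrow> \<bar>T x j\<bar> \<le> B * sup_norm x"
    using bounded_linear_on_seqs_bound[OF T] by blast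
  have "\<bar>(S - T) x j\<bar> \<le> (A + B) * sup_norm x" if x: "bounded_seq x" for x j
    using A(2)[OF x, of j] B(2)[OF x, of j] by (simp add: algebra_simps)
  moreover have "A + B \<ge> 0"
    using A(1) B(1) by simp
  ultimately show ?thesis
    unfolding bounded_linear_on_seqs_def
    by (auto simp: bounded_linear_on_seqs_diff[OF T] bounded_linear_on_seqs_diff[OF S]
        bounded_linear_on_seqs_scale[OF T] bounded_linear_on_seqs_scale[OF S]
        fun_eq_iff algebra_simps)
qed

section \<open>The operator norm inequality\<close>

lemma sup_norm_apply_le_op_norm:
  assumes T: "bounded_linear_on_seqs T" and x: "bounded_seq x" "sup_norm x \<le> 1"
  shows "sup_norm (T x) \<le> op_norm T"
proof -
  obtain B where B: "B \<ge> 0" "\<And>y j. bounded_seq y \<Longrightarrow> \<bar>T y j\<bar> \<le> B * sup_norm y"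
    using bounded_linear_on_seqs_bound[OF T] by blast
  have "sup_norm (T y) \<le> B" if "bounded_seq y" "sup_norm y \<le> 1" for y
  proof (rule sup_norm_le)
    show "\<bar>T y j\<bar> \<le> B" for j
      using B(2)[OF that(1), of j] mult_left_mono[OF that(2) B(1)] by linarith
  qed
  then have "bdd_above ((\<lambda>y. sup_norm (T y)) ` {y. bounded_seq y \<and> sup_norm y \<le> 1})"
    by (intro bdd_aboveI2) auto
  then show ?thesis
    unfolding op_norm_def using x by (intro cSUP_upper) auto
qed

lemma op_norm_nonneg:
  assumes "bounded_linear_on_seqs T"
  shows "0 \<le> op_norm T"
proof -
  have b: "bounded_seq (\<lambda>_. 0)" and le: "sup_norm (\<lambda>_. 0) \<le> 1"
    by (auto intro: bounded_seqI[of _ 0] sup_norm_le)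
  show ?thesis
    using sup_norm_apply_le_op_norm[OF assms b le]
      sup_norm_nonneg[OF bounded_linear_on_seqs_bounded[OF assms b]] by linarith
qed

text \<open>
  The sequence is normalised to sup norm 1, and homogeneity carries the bound back. A sequence of
  norm 0 cannot be normalised; there boundedness of the operator forces the image to vanish.
\<close>

lemma sup_norm_apply_le:
  assumes T: "bounded_linear_on_seqs T" and x: "bounded_seq x"
  shows "sup_norm (T x) \<le> op_norm T * sup_norm x"
proof (cases "sup_norm x = 0")
  case True
  obtain B where "\<And>y j. bounded_seq y \<Longrightarrow> \<bar>T y j\<bar> \<le> B * sup_norm y"
    using bounded_linear_on_seqs_bound[OF T] by blast
  from this[OF x] True show ?thesis
    by (intro sup_norm_le) simp
next
  case False
  define s where "s = sup_norm x"
  have s: "s > 0"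
    using False sup_norm_nonneg[OF x] by (simp add: s_def)
  define y where "y = (\<lambda>j. (1 / s) * x j)"
  have y: "bounded_seq y"
    unfolding y_def by (rule bounded_seq_scale[OF x])
  have "\<bar>y j\<bar> \<le> 1" for j
    using abs_le_sup_norm[OF x, of j] s by (simp add: y_def s_def)
  then have "sup_norm (T y) \<le> op_norm T"
    by (intro sup_norm_apply_le_op_norm[OF T y] sup_norm_le)
  then have bound: "\<bar>T y j\<bar> \<le> op_norm T" for j
    using abs_le_sup_norm[OF bounded_linear_on_seqs_bounded[OF T y], of j] by linarith
  have x_eq: "x = (\<lambda>j. s * y j)"
    using s by (simp add: y_def fun_eq_iff)
  have "T x = (\<lambda>j. s * T y j)"
    by (subst x_eq) (rule bounded_linear_on_seqs_scale[OF T y])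
  then have "\<bar>T x j\<bar> \<le> op_norm T * s" for j
    using bound[of j] s by (simp add: abs_mult mult.commute)
  then show ?thesis
    unfolding s_def by (rule sup_norm_le)
qed

section \<open>Subdivision and decimation are bounded\<close>

text \<open>
  A matrix whose rows have uniformly bounded absolute sums acts boundedly. The map \<open>f\<close>
  allows the operator to read only a part of its input, as decimation does.
\<close>

lemma row_summable_bounded_linear:
  fixes K :: "int \<Rightarrow> int \<Rightarrow> real" and f :: "int \<Rightarrow> int"
  assumes summable: "\<And>j. (\<lambda>i. \<bar>K j i\<bar>) summable_on UNIV"
    and row_le: "\<And>j. (\<Sum>\<^sub>\<infinity>i. \<bar>K j i\<bar>) \<le> B"
  shows "bounded_linear_on_seqs (\<lambda>x j. \<Sum>\<^sub>\<infinity>i. K j i * x (f i))"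
proof -
  have dominated: "(\<lambda>i. \<bar>K j i * x (f i)\<bar>) summable_on UNIV" if "bounded_seq x" for x j
  proof (rule summable_on_comparison_test)
    show "(\<lambda>i. \<bar>K j i\<bar> * sup_norm x) summable_on UNIV"
      by (rule summable_on_cmult_left[OF summable])
  qed (auto simp: abs_mult intro: mult_left_mono abs_le_sup_norm[OF that])
  then have summable': "(\<lambda>i. K j i * x (f i)) summable_on UNIV" if "bounded_seq x" for x j
    using that summable_on_iff_abs_summable_on_real by fastforce
  have "\<bar>\<Sum>\<^sub>\<infinity>i. K j i * x (f i)\<bar> \<le> B * sup_norm x" if x: "bounded_seq x" for x j
  proof -
    have "\<bar>\<Sum>\<^sub>\<infinity>i. K j i * x (f i)\<bar> \<le> (\<Sum>\<^sub>\<infinity>i. \<bar>K j i * x (f i)\<bar>)"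
      using norm_infsum_bound[of "\<lambda>i. K j i * x (f i)" UNIV] dominated[OF x] by simp
    also have "\<dots> \<le> (\<Sum>\<^sub>\<infinity>i. \<bar>K j i\<bar> * sup_norm x)"
      by (intro infsum_mono dominated[OF x] summable_on_cmult_left[OF summable])
        (simp add: abs_mult mult_left_mono abs_le_sup_norm[OF x])
    also have "\<dots> = (\<Sum>\<^sub>\<infinity>i. \<bar>K j i\<bar>) * sup_norm x"
      by (rule infsum_cmult_left')
    also have "\<dots> \<le> B * sup_norm x"
      by (intro mult_right_mono row_le sup_norm_nonneg[OF x])
    finally show ?thesis .
  qed
  moreover have "B \<ge> 0"
    using infsum_nonneg[of UNIV "\<lambda>i. \<bar>K 0 i\<bar>"] row_le[of 0] by simp
  moreover have "(\<Sum>\<^sub>\<infinity>i. K j i * (x - y) (f i)) =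
      (\<Sum>\<^sub>\<infinity>i. K j i * x (f i)) - (\<Sum>\<^sub>\<infinity>i. K j i * y (f i))"
    if "bounded_seq x" "bounded_seq y" for x y j
    using infsum_add[OF summable'[OF that(1), of j]
        summable_on_uminus[THEN iffD2, OF summable'[OF that(2), of j]]]
    by (simp add: right_diff_distrib infsum_uminus)
  moreover have "(\<Sum>\<^sub>\<infinity>i. K j i * (r * x (f i))) = r * (\<Sum>\<^sub>\<infinity>i. K j i * x (f i))" for r x j
    using infsum_cmult_right'[of r "\<lambda>i. K j i * x (f i)" UNIV] by (simp add: mult.left_commute)
  ultimately show ?thesis
    unfolding bounded_linear_on_seqs_def by (auto simp: fun_eq_iff)
qed

text \<open>
  Injectivity is what makes the bound uniform: each matrix row contains every entry of the mask at
  most once, so its absolute sum is at most that of the mask.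
\<close>

lemma mask_operator_bounded_linear:
  fixes g :: "int \<Rightarrow> int \<Rightarrow> int" and f :: "int \<Rightarrow> int"
  assumes a: "absolutely_summable a" and inj: "\<And>j. inj (g j)"
  shows "bounded_linear_on_seqs (\<lambda>x j. \<Sum>\<^sub>\<infinity>i. a (g j i) * x (f i))"
proof (rule row_summable_bounded_linear[where K = "\<lambda>j i. a (g j i)"])
  have a': "(\<lambda>i. \<bar>a i\<bar>) summable_on UNIV"
    using a by (simp add: absolutely_summable_def)
  have sub: "(\<lambda>i. \<bar>a i\<bar>) summable_on range (g j)" for j
    using a' by (rule summable_on_subset_banach) simp
  show "(\<lambda>i. \<bar>a (g j i)\<bar>) summable_on UNIV" for j
    using summable_on_reindex[OF inj, of "\<lambda>i. \<bar>a i\<bar>" j] sub by (simp add: o_def)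
  have "(\<Sum>\<^sub>\<infinity>i. \<bar>a (g j i)\<bar>) = (\<Sum>\<^sub>\<infinity>i\<in>range (g j). \<bar>a i\<bar>)" for j
    using infsum_reindex[OF inj, of "\<lambda>i. \<bar>a i\<bar>" j] by (simp add: o_def)
  also have "\<dots> j \<le> (\<Sum>\<^sub>\<infinity>i. \<bar>a i\<bar>)" for j
    by (rule infsum_mono2[OF sub a']) auto
  finally show "(\<Sum>\<^sub>\<infinity>i. \<bar>a (g j i)\<bar>) \<le> (\<Sum>\<^sub>\<infinity>i. \<bar>a i\<bar>)" for j .
qed

lemma finitely_supported_imp_absolutely_summable:
  assumes "finitely_supported a"
  shows "absolutely_summable a"
proof -
  have "(\<lambda>i. \<bar>a i\<bar>) summable_on {i. a i \<noteq> 0}"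
    using assms by (intro summable_on_finite) (simp add: finitely_supported_def)
  then show ?thesis
    unfolding absolutely_summable_def
    by (subst summable_on_cong_neutral[where T = "{i. a i \<noteq> 0}" and g = "\<lambda>i. \<bar>a i\<bar>"]) auto
qed

lemma bounded_linear_subdivision:
  assumes "absolutely_summable a"
  shows "bounded_linear_on_seqs (subdivision a)"
  unfolding subdivision_def
  using mask_operator_bounded_linear[OF assms, of "\<lambda>j i. j - 2 * i" "\<lambda>i. i"]
  by (simp add: inj_on_def)

lemma bounded_linear_decimation:
  assumes "absolutely_summable g"
  shows "bounded_linear_on_seqs (decimation g)"
  unfolding decimation_def
  using mask_operator_bounded_linear[OF assms, of "\<lambda>j i. j - i" "\<lambda>i. 2 * i"]
  by (simp add: inj_on_def)

section \<open>Iterated decimation and stability\<close>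

lemma Q_op_self: "Q_op \<gamma> J J = id"
  unfolding Q_op_def by simp

lemma Q_op_step: "l < J \<Longrightarrow> Q_op \<gamma> l J = decimation (\<gamma> (Suc l)) \<circ> Q_op \<gamma> (Suc l) J"
  unfolding Q_op_def by (simp add: upt_conv_Cons del: upt_Suc)

lemma bounded_linear_Q_op:
  assumes "l \<le> J" and "\<And>k. k \<in> {1..J} \<Longrightarrow> absolutely_summable (\<gamma> k)"
  shows "bounded_linear_on_seqs (Q_op \<gamma> l J)"
  using assms(1)
proof (induction rule: inc_induct)
  case base
  show ?case
    unfolding Q_op_self by (rule bounded_linear_on_seqs_id)
next
  case (step l)
  show ?case
    unfolding Q_op_step[OF step.hyps(2)] using step
    by (intro bounded_linear_on_seqs_comp bounded_linear_decimation assms(2)) simp_all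
qed

lemma multiscale_rep_coarse:
  assumes "multiscale_rep \<alpha> \<gamma> J c d" and "l \<le> J"
  shows "c l = Q_op \<gamma> l J (c J)"
  using assms(2)
proof (induction rule: inc_induct)
  case base
  show ?case
    by (simp add: Q_op_self)
next
  case (step l)
  have "Suc l \<in> {1..J}"
    using step by simp
  then have "c l = decimation (\<gamma> (Suc l)) (c (Suc l))"
    using assms(1) unfolding multiscale_rep_def by fastforce
  then show ?case
    using step by (simp add: Q_op_step)
qed

lemma multiscale_rep_detail:
  assumes "multiscale_rep \<alpha> \<gamma> J c d" and "l \<in> {1..J}"
  shows "d l = (id - (subdivision (\<alpha> l) \<circ> decimation (\<gamma> l))) (c l)"
  using assms unfolding multiscale_rep_def by simp

theorem theorem3p7:
  fixes J :: nat
    and \<alpha> \<gamma> :: "nat \<Rightarrow> seq"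
    and c c' d d' :: "nat \<Rightarrow> seq"
  assumes "bounded_seq (c J)" and "bounded_seq (c' J)"
    and "\<And>l. l \<in> {1..J} \<Longrightarrow> finitely_supported (\<alpha> l)"
    and "\<And>l. l \<in> {1..J} \<Longrightarrow> absolutely_summable (\<gamma> l)"
    and "\<And>l. l \<in> {1..J} \<Longrightarrow> seq_conv (\<gamma> l) (downsample (\<alpha> l)) = delta"
    and "\<And>l. l \<in> {1..J} \<Longrightarrow> (\<Sum>\<^sub>\<infinity>i. \<gamma> l i) = 1"
    and "multiscale_rep \<alpha> \<gamma> J c d"
    and "multiscale_rep \<alpha> \<gamma> J c' d'"
  shows "sup_norm (c 0 - c' 0) \<le> op_norm (Q_op \<gamma> 0 J) * sup_norm (c J - c' J) \<and>
    (\<forall>l\<in>{1..J}. sup_norm (d l - d' l) \<le>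
        op_norm (id - (subdivision (\<alpha> l) \<circ> decimation (\<gamma> l))) * op_norm (Q_op \<gamma> l J) *
        sup_norm (c J - c' J))"
proof -
  note Q = bounded_linear_Q_op[of _ J \<gamma>, OF _ assms(4)]
  have coarse: "sup_norm (c l - c' l) \<le> op_norm (Q_op \<gamma> l J) * sup_norm (c J - c' J)"
    if l: "l \<le> J" for l
  proof -
    have "c l - c' l = Q_op \<gamma> l J (c J - c' J)"
      using multiscale_rep_coarse[OF assms(7) l] multiscale_rep_coarse[OF assms(8) l]
        bounded_linear_on_seqs_diff[OF Q[OF l] assms(1,2)] by simp
    then show ?thesis
      using sup_norm_apply_le[OF Q[OF l] bounded_seq_diff[OF assms(1,2)]] by simp
  qed
  moreover have "sup_norm (d l - d' l) \<le>
      op_norm (id - (subdivision (\<alpha> l) \<circ> decimation (\<gamma> l))) * op_norm (Q_op \<gamma> l J) *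
        sup_norm (c J - c' J)"
    if l: "l \<in> {1..J}" for l
  proof -
    define T where "T = id - (subdivision (\<alpha> l) \<circ> decimation (\<gamma> l))"
    have T: "bounded_linear_on_seqs T"
      unfolding T_def
      by (intro bounded_linear_on_seqs_minus bounded_linear_on_seqs_id bounded_linear_on_seqs_comp
          bounded_linear_subdivision[OF finitely_supported_imp_absolutely_summable]
          bounded_linear_decimation assms(3,4) l)
    have lJ: "l \<le> J"
      using l by simp
    have b: "bounded_seq (c l)" "bounded_seq (c' l)"
      using multiscale_rep_coarse[OF assms(7) lJ] multiscale_rep_coarse[OF assms(8) lJ]
        bounded_linear_on_seqs_bounded[OF Q[OF lJ]] assms(1,2) by simp_all
    have "d l - d' l = T (c l - c' l)"
      unfolding bounded_linear_on_seqs_diff[OF T b]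
      using multiscale_rep_detail[OF assms(7) l] multiscale_rep_detail[OF assms(8) l]
      by (simp add: T_def)
    then have "sup_norm (d l - d' l) \<le> op_norm T * sup_norm (c l - c' l)"
      using sup_norm_apply_le[OF T bounded_seq_diff[OF b]] by simp
    also have "\<dots> \<le> op_norm T * (op_norm (Q_op \<gamma> l J) * sup_norm (c J - c' J))"
      by (intro mult_left_mono coarse lJ op_norm_nonneg[OF T])
    finally show ?thesis
      by (simp add: T_def mult.assoc)
  qed
  ultimately show ?thesis
    by blast
qed

end
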